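(* Let $X$ be a Banach space, let $(A_n)_{n\in\mathbb{N}}$ be a sequence in $\mathcal{B}(X)$ defining the system $(\mathcal{A}):\ x_{n+1}=A_nx_n$, and let $(P_n)_{n\in\mathbb{N}}$ be a sequence of projectors that is strongly invariant for $(\mathcal{A})$, with complementary sequence $Q_n=I-P_n$ and skew-evolution operator $B$. Let $h,k:\mathbb{N}\to[1,\infty)$ be growth rates, and let $\tilde h:\mathbb{N}\to(0,\infty)$ be a sequence and $H\ge 1$ a constant such that $$\sum_{n=0}^{\infty}\frac{\tilde h_n}{h_n}\le H.$$ If the pair $(\mathcal{A},P)$ is $(h,k)$-dichotomic, then there exist a sequence of norms $\{|||\cdot|||_n : n\in\mathbb{N}\}$ on $X$, compatible with $(P_n)$, and a nondecreasing sequence $d:\mathbb{N}\to[1,\infty)$ such that for all $m\ge n\ge 0$ and all $x\in X$: $$\sum_{j=n}^{m}\tilde h_j\,|||A_j^nP_nx|||_j\le d_n\tilde h_n\,|||x|||_n \quad\text{and}\quad \sum_{j=n}^{m}k_j\,|||B_j^nQ_jx|||_n\le d_mk_n\,|||x|||_m .$$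
   Context: $\mathbb{N}$ is the set of nonnegative integers, $\mathcal{B}(X)$ is the algebra of bounded linear operators on $X$, $\|\cdot\|$ denotes the norm on $X$ and on $\mathcal{B}(X)$, and $I$ is the identity. For $m\ge n$, the evolution operator is $A_m^n=A_{m-1}\cdots A_n$ if $m>n$ and $A_n^n=I$. A sequence $(P_n)$ in $\mathcal{B}(X)$ is a sequence of projectors if $P_n^2=P_n$ for all $n$. It is invariant for $(\mathcal{A})$ if $A_nP_n=P_{n+1}A_n$ for all $n$. It is strongly invariant if it is invariant and, for all $m\ge n$, the restriction of $A_m^n$ to $\operatorname{Ker}P_n$ is an isomorphism from $\operatorname{Ker}P_n$ onto $\operatorname{Ker}P_m$. In that case, for $m\ge n$, $B_m^n$ (the skew-evolution operator) denotes the isomorphism $\operatorname{Ker}P_m\to\operatorname{Ker}P_n$ inverse to $A_m^n|_{\operatorname{Ker}P_n}$, so that $A_m^nB_m^nQ_m=Q_m$, $B_m^nA_m^nQ_n=Q_n$ and $Q_nB_m^nQ_m=B_m^nQ_m$. A growth rate is an increasing sequence $h:\mathbb{N}\to[1,\infty)$ with $\lim_{n\to\infty}h_n=\infty$. The pair $(\mathcal{A},P)$ is $(h,k)$-dichotomic if there is a nondecreasing sequence $d:\mathbb{N}\to[1,\infty)$ such that $h_m\|A_m^nP_nx\|\le d_nh_n\|P_nx\|$ and $k_m\|Q_nx\|\le d_mk_n\|A_m^nQ_nx\|$ for all $m\ge n\ge0$ and $x\in X$. A sequence of norms $\{|||\cdot|||_n\}$ on $X$ is compatible with $(P_n)$ if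 there is a nondecreasing sequence $c:\mathbb{N}\to[1,\infty)$ such that $\|x\|\le|||x|||_n\le c_n(\|P_nx\|+\|Q_nx\|)$ for all $n\in\mathbb{N}$, $x\in X$. *)

theory Defs
  imports "HOL-Analysis.Analysis"
begin

text \<open>The evolution operator, \<open>evolution A m n\<close> being $A_{m-1} \cdots A_n$ for \<open>n \<le> m\<close>.
  It is only meaningful for \<open>n \<le> m\<close>; below the diagonal it takes the dummy value \<open>id_blinfun\<close>.\<close>

primrec evolution ::
    "(nat \<Rightarrow> 'a::real_normed_vector \<Rightarrow>\<^sub>L 'a) \<Rightarrow> nat \<Rightarrow> nat \<Rightarrow> 'a \<Rightarrow>\<^sub>L 'a" where
  "evolution A 0 n = id_blinfun"
| "evolution A (Suc m) n = (if n \<le> m then A m o\<^sub>L evolution A m n else id_blinfun)"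

definition kernel :: "('a::real_normed_vector \<Rightarrow>\<^sub>L 'a) \<Rightarrow> 'a set" where
  "kernel T = {x. blinfun_apply T x = 0}"

definition projectors :: "(nat \<Rightarrow> 'a::real_normed_vector \<Rightarrow>\<^sub>L 'a) \<Rightarrow> bool" where
  "projectors P \<longleftrightarrow> (\<forall>n. P n o\<^sub>L P n = P n)"

definition complementary ::
    "(nat \<Rightarrow> 'a::real_normed_vector \<Rightarrow>\<^sub>L 'a) \<Rightarrow> nat \<Rightarrow> 'a \<Rightarrow>\<^sub>L 'a" where
  "complementary P n = id_blinfun - P n"

definition invariant_for ::
    "(nat \<Rightarrow> 'a::real_normed_vector \<Rightarrow>\<^sub>L 'a) \<Rightarrow> (nat \<Rightarrow> 'a \<Rightarrow>\<^sub>L 'a) \<Rightarrow> bool" where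
  "invariant_for A P \<longleftrightarrow> (\<forall>n. A n o\<^sub>L P n = P (Suc n) o\<^sub>L A n)"

text \<open>An isomorphism of normed spaces is a bounded linear bijection with bounded inverse. As the
  evolution operator is bounded and linear, its restriction is such an isomorphism between the
  two kernels iff it is a homeomorphism between them.\<close>

definition strongly_invariant_for ::
    "(nat \<Rightarrow> 'a::real_normed_vector \<Rightarrow>\<^sub>L 'a) \<Rightarrow> (nat \<Rightarrow> 'a \<Rightarrow>\<^sub>L 'a) \<Rightarrow> bool" where
  "strongly_invariant_for A P \<longleftrightarrow> invariant_for A P \<and>
     (\<forall>m n. n \<le> m \<longrightarrow>
        (\<exists>B. homeomorphism (kernel (P n)) (kernel (P m)) (blinfun_apply (evolution A m n)) B))"

text \<open>For strongly invariant projectors and \<open>n \<le> m\<close>, \<open>skew_evolution A P m n\<close> is the inverse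
  isomorphism from \<open>kernel (P m)\<close> onto \<open>kernel (P n)\<close>; its values outside \<open>kernel (P m)\<close> are
  meaningless.\<close>

definition skew_evolution ::
    "(nat \<Rightarrow> 'a::real_normed_vector \<Rightarrow>\<^sub>L 'a) \<Rightarrow> (nat \<Rightarrow> 'a \<Rightarrow>\<^sub>L 'a) \<Rightarrow> nat \<Rightarrow> nat \<Rightarrow> 'a \<Rightarrow> 'a" where
  "skew_evolution A P m n = inv_into (kernel (P n)) (blinfun_apply (evolution A m n))"

text \<open>``Increasing'' is read as strictly increasing, as opposed to the merely nondecreasing
  sequences in the definitions below.\<close>

definition growth_rate :: "(nat \<Rightarrow> real) \<Rightarrow> bool" where
  "growth_rate h \<longleftrightarrow> (\<forall>n. 1 \<le> h n) \<and> strict_mono h \<and> filterlim h at_top sequentially"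

definition nondecreasing_ge_one :: "(nat \<Rightarrow> real) \<Rightarrow> bool" where
  "nondecreasing_ge_one d \<longleftrightarrow> mono d \<and> (\<forall>n. 1 \<le> d n)"

definition dichotomic ::
    "(nat \<Rightarrow> real) \<Rightarrow> (nat \<Rightarrow> real) \<Rightarrow>
     (nat \<Rightarrow> 'a::real_normed_vector \<Rightarrow>\<^sub>L 'a) \<Rightarrow> (nat \<Rightarrow> 'a \<Rightarrow>\<^sub>L 'a) \<Rightarrow> bool" where
  "dichotomic h k A P \<longleftrightarrow>
     (\<exists>d. nondecreasing_ge_one d \<and>
        (\<forall>m n x. n \<le> m \<longrightarrow>
           h m * norm (evolution A m n (P n x)) \<le> d n * h n * norm (P n x) \<and>
           k m * norm (complementary P n x)
             \<le> d m * k n * norm (evolution A m n (complementary P n x))))"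

definition is_norm :: "('a::real_vector \<Rightarrow> real) \<Rightarrow> bool" where
  "is_norm N \<longleftrightarrow>
     (\<forall>x. 0 \<le> N x) \<and> (\<forall>x. N x = 0 \<longleftrightarrow> x = 0) \<and>
     (\<forall>x y. N (x + y) \<le> N x + N y) \<and> (\<forall>a x. N (a *\<^sub>R x) = \<bar>a\<bar> * N x)"

definition compatible_norms ::
    "(nat \<Rightarrow> 'a::real_normed_vector \<Rightarrow> real) \<Rightarrow> (nat \<Rightarrow> 'a \<Rightarrow>\<^sub>L 'a) \<Rightarrow> bool" where
  "compatible_norms N P \<longleftrightarrow>
     (\<forall>n. is_norm (N n)) \<and>
     (\<exists>c. nondecreasing_ge_one c \<and>
        (\<forall>n x. norm x \<le> N n x \<and>
           N n x \<le> c n * (norm (P n x) + norm (complementary P n x))))"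

end

theory Submission
  imports Defs
begin

text \<open>Take \<open>|||x|||\<^sub>n = sup {h\<^sub>m \<parallel>A\<^sub>m\<^sup>n P\<^sub>n x\<parallel> / h\<^sub>n | m \<ge> n} + \<parallel>Q\<^sub>n x\<parallel>\<close>. On the orbit of \<open>P\<^sub>n x\<close> the
  supremum can only shrink, so \<open>h\<^sub>j |||A\<^sub>j\<^sup>n P\<^sub>n x|||\<^sub>j \<le> h\<^sub>n |||x|||\<^sub>n\<close>; multiplying by \<open>h'\<^sub>j / h\<^sub>j\<close>
  and summing gives the first estimate. On \<open>Ker P\<^sub>n\<close> the new norm is the old one, so the second
  estimate is a finite sum of the dichotomy bounds, which \<open>d\<^sub>m\<close> can absorb.\<close>

text \<open>The factor \<open>1 / h n\<close> of the adapted norm is left out, so the weights do not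
  depend on the starting index and suprema started at different points of one orbit can be compared
  directly.\<close>

definition orbit_sup ::
    "(nat \<Rightarrow> real) \<Rightarrow> (nat \<Rightarrow> 'a::real_normed_vector \<Rightarrow>\<^sub>L 'a) \<Rightarrow> nat \<Rightarrow> 'a \<Rightarrow> real" where
  "orbit_sup h A n x = (SUP m\<in>{n..}. h m * norm (evolution A m n x))"

text \<open>The real \<open>SUP\<close> of an unbounded set is unspecified, so bounding a term by
  \<open>orbit_sup\<close> requires this. The dichotomy supplies it for vectors in the range of
  \<open>P n\<close>.\<close>

definition orbit_bounded ::
    "(nat \<Rightarrow> real) \<Rightarrow> (nat \<Rightarrow> 'a::real_normed_vector \<Rightarrow>\<^sub>L 'a) \<Rightarrow> nat \<Rightarrow> 'a \<Rightarrow> bool" where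
  "orbit_bounded h A n x \<longleftrightarrow> bdd_above ((\<lambda>m. h m * norm (evolution A m n x)) ` {n..})"

definition adapted_norm ::
    "(nat \<Rightarrow> real) \<Rightarrow> (nat \<Rightarrow> 'a::real_normed_vector \<Rightarrow>\<^sub>L 'a) \<Rightarrow> (nat \<Rightarrow> 'a \<Rightarrow>\<^sub>L 'a) \<Rightarrow>
     nat \<Rightarrow> 'a \<Rightarrow> real" where
  "adapted_norm h A P n x = orbit_sup h A n (P n x) / h n + norm (complementary P n x)"

section \<open>Algebra of the evolution operator and the projectors\<close>

lemma evolution_self [simp]: "evolution A n n = id_blinfun"
  by (cases n) auto

lemma evolution_compose:
  assumes "n \<le> j" "j \<le> m"
  shows "evolution A m j (evolution A j n x) = evolution A m n x"
  using assms(2,1) by (induction m rule: dec_induct) auto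

lemma evolution_projector:
  assumes "invariant_for A P" "n \<le> m"
  shows "evolution A m n (P n x) = P m (evolution A m n x)"
  using assms(2)
proof (induction m rule: dec_induct)
  case (step m)
  have "A m (P m y) = P (Suc m) (A m y)" for y
    using assms(1) unfolding invariant_for_def by (metis blinfun_apply_blinfun_compose)
  with step show ?case by simp
qed simp

lemma complementary_apply: "complementary P n x = x - P n x"
  by (simp add: complementary_def blinfun.diff_left)

lemma projector_idem: "projectors P \<Longrightarrow> P n (P n x) = P n x"
  unfolding projectors_def by (metis blinfun_apply_blinfun_compose)

section \<open>Suprema of weighted norms along orbits\<close>

lemma norm_le_orbit_sup:
  assumes "orbit_bounded h A n x" "n \<le> m"
  shows "h m * norm (evolution A m n x) \<le> orbit_sup h A n x"
  unfolding orbit_sup_def using assms by (intro cSUP_upper) (auto simp: orbit_bounded_def)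

lemma orbit_sup_least:
  assumes "\<And>m. n \<le> m \<Longrightarrow> h m * norm (evolution A m n x) \<le> c"
  shows "orbit_sup h A n x \<le> c"
  unfolding orbit_sup_def using assms by (intro cSUP_least) auto

lemma orbit_sup_zero [simp]: "orbit_sup h A n 0 = 0"
  by (simp add: orbit_sup_def)

text \<open>By the composition rule, the terms of the left supremum are exactly those terms of the
  right one whose index is at least \<open>j\<close>.\<close>

lemma orbit_sup_evolution_le:
  assumes "orbit_bounded h A n x" "n \<le> j"
  shows "orbit_sup h A j (evolution A j n x) \<le> orbit_sup h A n x"
  using assms by (intro orbit_sup_least) (simp add: evolution_compose norm_le_orbit_sup)

lemma orbit_sup_add_le:
  assumes h: "\<And>m. 0 \<le> h m" and x: "orbit_bounded h A n x" and y: "orbit_bounded h A n y"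
  shows "orbit_sup h A n (x + y) \<le> orbit_sup h A n x + orbit_sup h A n y"
proof (rule orbit_sup_least)
  fix m assume m: "n \<le> m"
  have "h m * norm (evolution A m n (x + y))
      \<le> h m * norm (evolution A m n x) + h m * norm (evolution A m n y)"
    using h[of m]
    by (simp add: blinfun.add_right mult_left_mono norm_triangle_ineq flip: distrib_left)
  also have "\<dots> \<le> orbit_sup h A n x + orbit_sup h A n y"
    using norm_le_orbit_sup[OF x m] norm_le_orbit_sup[OF y m] by (rule add_mono)
  finally show "h m * norm (evolution A m n (x + y)) \<le> \<dots>" .
qed

text \<open>The inequality \<le> holds termwise; applied to \<open>a *\<^sub>R x\<close> and the
  scalar \<open>inverse a\<close> it also yields the reverse one. This second use is why
  \<open>S\<close> has to be closed under scaling. In the application \<open>S\<close> is the range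
  of \<open>P n\<close>.\<close>

lemma orbit_sup_scaleR:
  assumes bdd: "\<And>x. x \<in> S \<Longrightarrow> orbit_bounded h A n x"
    and "x \<in> S" and S: "\<And>a x. x \<in> S \<Longrightarrow> a *\<^sub>R x \<in> S"
  shows "orbit_sup h A n (a *\<^sub>R x) = \<bar>a\<bar> * orbit_sup h A n x"
proof (cases "a = 0")
  case False
  have le: "orbit_sup h A n (b *\<^sub>R y) \<le> \<bar>b\<bar> * orbit_sup h A n y" if "y \<in> S" for b y
    by (rule orbit_sup_least)
      (simp add: blinfun.scaleR_right mult.left_commute mult_left_mono norm_le_orbit_sup bdd that)
  have "orbit_sup h A n x \<le> \<bar>inverse a\<bar> * orbit_sup h A n (a *\<^sub>R x)"
    using le[OF S[OF \<open>x \<in> S\<close>], of "inverse a" a] False by simp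
  with False have "\<bar>a\<bar> * orbit_sup h A n x \<le> orbit_sup h A n (a *\<^sub>R x)"
    by (simp add: field_simps)
  with le[OF \<open>x \<in> S\<close>] show ?thesis by (intro antisym)
qed simp

section \<open>The adapted norms\<close>

lemma norm_le_adapted_norm:
  fixes P :: "nat \<Rightarrow> 'a::real_normed_vector \<Rightarrow>\<^sub>L 'a"
  assumes "0 < h n" "orbit_bounded h A n (P n x)"
  shows "norm (P n x) + norm (complementary P n x) \<le> adapted_norm h A P n x"
  \<comment> \<open>The term \<open>m = n\<close> of the supremum is
    \<open>h n * norm (P n x)\<close>.\<close>
  using norm_le_orbit_sup[OF assms(2) order_refl] assms(1)
  by (simp add: adapted_norm_def field_simps)

lemma norm_le_projector_parts:
  fixes P :: "nat \<Rightarrow> 'a::real_normed_vector \<Rightarrow>\<^sub>L 'a"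
  shows "norm x \<le> norm (P n x) + norm (complementary P n x)"
  using norm_triangle_ineq[of "P n x" "complementary P n x"] by (simp add: complementary_apply)

text \<open>Nonnegativity and definiteness follow because the original norm is a lower bound;
  subadditivity and homogeneity are inherited from the supremum and from the norm of the
  complementary part.\<close>

lemma is_norm_adapted_norm:
  fixes A P :: "nat \<Rightarrow> 'a::real_normed_vector \<Rightarrow>\<^sub>L 'a"
  assumes h: "\<And>m. 0 < h m" and bdd: "\<And>x. orbit_bounded h A n (P n x)"
  shows "is_norm (adapted_norm h A P n)"
proof -
  let ?N = "adapted_norm h A P n"
  have ge: "norm x \<le> ?N x" for x
    using norm_le_projector_parts[of x P n] norm_le_adapted_norm[of h n A P x, OF h bdd] by linarith
  have "0 \<le> ?N x" for x
    using ge[of x] norm_ge_zero[of x] by linarith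
  moreover have "?N x = 0 \<longleftrightarrow> x = 0" for x
  proof
    assume "?N x = 0"
    with ge[of x] show "x = 0" by simp
  qed (simp add: adapted_norm_def)
  moreover have "?N (x + y) \<le> ?N x + ?N y" for x y
  proof -
    have "orbit_sup h A n (P n (x + y)) \<le> orbit_sup h A n (P n x) + orbit_sup h A n (P n y)"
      using orbit_sup_add_le[OF less_imp_le[OF h] bdd bdd] by (simp add: blinfun.add_right)
    then have "orbit_sup h A n (P n (x + y)) / h n
        \<le> orbit_sup h A n (P n x) / h n + orbit_sup h A n (P n y) / h n"
      using h[of n] by (simp add: divide_right_mono flip: add_divide_distrib)
    moreover have "norm (complementary P n (x + y))
        \<le> norm (complementary P n x) + norm (complementary P n y)"
      by (simp add: blinfun.add_right norm_triangle_ineq)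
    ultimately show ?thesis by (simp add: adapted_norm_def)
  qed
  moreover have "?N (a *\<^sub>R x) = \<bar>a\<bar> * ?N x" for a x
  proof -
    have "orbit_sup h A n (a *\<^sub>R P n x) = \<bar>a\<bar> * orbit_sup h A n (P n x)"
      by (rule orbit_sup_scaleR[where S = "range (P n)"])
        (use bdd in \<open>auto simp flip: blinfun.scaleR_right\<close>)
    then show ?thesis
      by (simp add: adapted_norm_def blinfun.scaleR_right distrib_left)
  qed
  ultimately show ?thesis by (simp add: is_norm_def)
qed

text \<open>Invariance keeps the orbit of \<open>P n x\<close> in the range of \<open>P j\<close>,
  so the complementary part of the norm vanishes there. Multiplying by \<open>h j\<close> leaves the
  supremum started at \<open>j\<close>, which is at most the one started at
  \<open>n\<close>.\<close>

lemma adapted_norm_evolution_le: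
  assumes "projectors P" "invariant_for A P" "0 < h j" "orbit_bounded h A n (P n x)" "n \<le> j"
  shows "h j * adapted_norm h A P j (evolution A j n (P n x)) \<le> orbit_sup h A n (P n x)"
proof -
  have "P j (evolution A j n (P n x)) = evolution A j n (P n x)"
    using assms by (simp add: projector_idem flip: evolution_projector)
  then show ?thesis
    using orbit_sup_evolution_le[OF assms(4,5)] assms(3)
    by (simp add: adapted_norm_def complementary_apply)
qed

lemma adapted_norm_kernel: "x \<in> kernel (P n) \<Longrightarrow> adapted_norm h A P n x = norm x"
  by (simp add: adapted_norm_def kernel_def complementary_apply)

section \<open>The skew-evolution operator as a right inverse on the kernels\<close>

lemma skew_evolution_inverse:
  assumes "strongly_invariant_for A P" "n \<le> m" "x \<in> kernel (P m)"
  shows "skew_evolution A P m n x \<in> kernel (P n)"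
    and "evolution A m n (skew_evolution A P m n x) = x"
proof -
  have "evolution A m n ` kernel (P n) = kernel (P m)"
    using assms unfolding strongly_invariant_for_def homeomorphism_def by blast
  with assms(3) have "x \<in> evolution A m n ` kernel (P n)" by simp
  then show "skew_evolution A P m n x \<in> kernel (P n)"
    and "evolution A m n (skew_evolution A P m n x) = x"
    unfolding skew_evolution_def by (rule inv_into_into, rule f_inv_into_f)
qed

section \<open>Choice of the constants and the two sum estimates\<close>

theorem theorem7:
  fixes A P :: "nat \<Rightarrow> 'a::banach \<Rightarrow>\<^sub>L 'a"
    and h k h' :: "nat \<Rightarrow> real"
    and H :: real
  assumes "projectors P"
    and "strongly_invariant_for A P"
    and "growth_rate h"
    and "growth_rate k"
    and "\<And>n. 0 < h' n"
    and "1 \<le> H"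
    and "summable (\<lambda>n. h' n / h n)"
    and "(\<Sum>n. h' n / h n) \<le> H"
    and "dichotomic h k A P"
  shows "\<exists>(N :: nat \<Rightarrow> 'a \<Rightarrow> real) (d :: nat \<Rightarrow> real).
           compatible_norms N P \<and> nondecreasing_ge_one d \<and>
           (\<forall>m n x. n \<le> m \<longrightarrow>
              (\<Sum>j=n..m. h' j * N j (evolution A j n (P n x))) \<le> d n * h' n * N n x \<and>
              (\<Sum>j=n..m. k j * N n (skew_evolution A P j n (complementary P j x)))
                \<le> d m * k n * N m x)"
proof -
  obtain e where e: "nondecreasing_ge_one e"
    and stable: "\<And>m n x. n \<le> m \<Longrightarrow>
      h m * norm (evolution A m n (P n x)) \<le> e n * h n * norm (P n x)"
    and unstable: "\<And>m n x. n \<le> m \<Longrightarrow>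
      k m * norm (complementary P n x) \<le> e m * k n * norm (evolution A m n (complementary P n x))"
    using assms(9) unfolding dichotomic_def by blast
  have inv: "invariant_for A P"
    using assms(2) by (simp add: strongly_invariant_for_def)
  have h: "0 < h n" and k: "0 < k n" for n
    using assms(3,4) by (simp_all add: growth_rate_def less_le_trans[OF zero_less_one])
  have e1: "1 \<le> e n" for n
    using e by (simp add: nondecreasing_ge_one_def)
  have bdd: "orbit_bounded h A n (P n x)" for n x
    unfolding orbit_bounded_def
    by (rule bdd_aboveI2[where M = "e n * h n * norm (P n x)"]) (simp add: stable)
  define N where "N = adapted_norm h A P"
  \<comment> \<open>\<open>b j\<close> is the cost of the \<open>j\<close>-th term in the second
    estimate: \<open>e j\<close> comes from the dichotomy, and the operator norm from bounding the
    complementary part of \<open>x\<close> by \<open>x\<close>.\<close>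
  define b where "b j = e j * norm (complementary P j)" for j
  \<comment> \<open>The first estimate needs \<open>d n\<close> above \<open>H * h n / h' n\<close>,
    the second needs \<open>d m\<close> above the sum of all \<open>b j\<close> with
    \<open>j \<le> m\<close>. Summing both up to the index makes \<open>d\<close> nondecreasing even
    where \<open>h n / h' n\<close> is not.\<close>
  define d where "d n = 1 + (\<Sum>i\<le>n. H * h i / h' i + b i)" for n
  have b0: "0 \<le> b j" for j
    using e1[of j] by (simp add: b_def)
  have c0: "0 \<le> H * h i / h' i" for i
    using assms(5)[of i] assms(6) h[of i] by simp
  have norm_N: "norm x \<le> N n x" for n x
    using norm_le_projector_parts[of x P n] norm_le_adapted_norm[of h n A P x, OF h bdd]
    unfolding N_def by linarith
  have N0: "0 \<le> N n x" for n x
    using norm_ge_zero norm_N by (rule order_trans)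
  \<comment> \<open>The dichotomy sequence \<open>e\<close> itself serves as the compatibility
    sequence: the stable bound holds for every term of the supremum.\<close>
  have "N n x \<le> e n * (norm (P n x) + norm (complementary P n x))" for n x
  proof -
    have "orbit_sup h A n (P n x) \<le> e n * h n * norm (P n x)"
      by (rule orbit_sup_least) (rule stable)
    then have "orbit_sup h A n (P n x) / h n \<le> e n * norm (P n x)"
      using h[of n] by (simp add: field_simps)
    moreover have "norm (complementary P n x) \<le> e n * norm (complementary P n x)"
      using e1[of n] mult_right_mono[of 1 "e n" "norm (complementary P n x)"] by simp
    ultimately show ?thesis by (simp add: N_def adapted_norm_def distrib_left)
  qed
  moreover have "is_norm (N n)" for n
    unfolding N_def using h bdd by (rule is_norm_adapted_norm)
  ultimately have "compatible_norms N P"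
    using e norm_N unfolding compatible_norms_def by blast
  moreover have "nondecreasing_ge_one d"
    using b0 c0 unfolding nondecreasing_ge_one_def d_def
    by (auto intro!: monoI add_left_mono sum_mono2 sum_nonneg add_nonneg_nonneg)
  moreover have "(\<Sum>j=n..m. h' j * N j (evolution A j n (P n x))) \<le> d n * h' n * N n x" for m n x
  proof -
    let ?s = "orbit_sup h A n (P n x)"
    have s: "?s \<le> h n * N n x"
      using h[of n] by (simp add: N_def adapted_norm_def field_simps)
    have s0: "0 \<le> ?s"
      using norm_le_orbit_sup[OF bdd order_refl, of n x] h[of n]
      by (meson less_imp_le mult_nonneg_nonneg norm_ge_zero order_trans)
    have "(\<Sum>j=n..m. h' j * N j (evolution A j n (P n x))) \<le> (\<Sum>j=n..m. h' j / h j * ?s)"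
    proof (rule sum_mono)
      fix j assume "j \<in> {n..m}"
      then have "h j * N j (evolution A j n (P n x)) \<le> ?s"
        unfolding N_def using assms(1) inv h bdd by (intro adapted_norm_evolution_le) auto
      then have "h' j / h j * (h j * N j (evolution A j n (P n x))) \<le> h' j / h j * ?s"
        using assms(5)[of j] h[of j] by (intro mult_left_mono) auto
      then show "h' j * N j (evolution A j n (P n x)) \<le> h' j / h j * ?s"
        using h[of j] by simp
    qed
    also have "\<dots> = (\<Sum>j=n..m. h' j / h j) * ?s"
      by (simp add: sum_distrib_right)
    also have "\<dots> \<le> H * ?s"
    proof (rule mult_right_mono[OF _ s0])
      have "(\<Sum>j=n..m. h' j / h j) \<le> (\<Sum>j. h' j / h j)"
        using assms(7) assms(5) h by (intro sum_le_suminf) (auto intro: less_imp_le)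
      with assms(8) show "(\<Sum>j=n..m. h' j / h j) \<le> H" by linarith
    qed
    also have "\<dots> \<le> H * (h n * N n x)"
      using s assms(6) by (intro mult_left_mono) auto
    \<comment> \<open>The bound obtained so far carries the weight \<open>h n\<close>, the claim
      carries \<open>h' n\<close>; their quotient is moved into \<open>d n\<close>.\<close>
    also have "\<dots> = H * h n / h' n * (h' n * N n x)"
      using assms(5)[of n] by simp
    also have "\<dots> \<le> d n * (h' n * N n x)"
    proof (rule mult_right_mono)
      have "H * h n / h' n + b n \<le> (\<Sum>i\<le>n. H * h i / h' i + b i)"
        by (rule member_le_sum) (use b0 c0 in auto)
      with b0[of n] show "H * h n / h' n \<le> d n" by (simp add: d_def)
      show "0 \<le> h' n * N n x"
        using assms(5)[of n] N0[of n x] by simp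
    qed
    finally show ?thesis by (simp add: mult.assoc)
  qed
  moreover have "(\<Sum>j=n..m. k j * N n (skew_evolution A P j n (complementary P j x)))
      \<le> d m * k n * N m x" for m n x
  proof -
    have "(\<Sum>j=n..m. k j * N n (skew_evolution A P j n (complementary P j x)))
        \<le> (\<Sum>j=n..m. b j * (k n * N m x))"
    proof (rule sum_mono)
      fix j assume "j \<in> {n..m}"
      then have j: "n \<le> j" by simp
      define z where "z = skew_evolution A P j n (complementary P j x)"
      have "complementary P j x \<in> kernel (P j)"
        using assms(1)
        by (simp add: kernel_def complementary_apply blinfun.diff_right projector_idem)
      from skew_evolution_inverse[OF assms(2) j this]
      have z: "z \<in> kernel (P n)" "evolution A j n z = complementary P j x"
        by (simp_all add: z_def)
      then have "complementary P n z = z"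
        by (simp add: complementary_apply kernel_def)
      \<comment> \<open>Since \<open>z\<close> lies in \<open>kernel (P n)\<close> and evolves to
        \<open>complementary P j x\<close>, the lower bound on the evolution operator becomes an
        upper bound on its inverse.\<close>
      with z unstable[OF j, of z] have "k j * N n z \<le> e j * k n * norm (complementary P j x)"
        by (simp add: N_def adapted_norm_kernel)
      \<comment> \<open>The projector has index \<open>j\<close> but the norm on the right has index
        \<open>m\<close>; the original norm, which lies below every \<open>N m\<close>, links the
        two.\<close>
      also have "\<dots> \<le> e j * k n * (norm (complementary P j) * N m x)"
      proof (rule mult_left_mono)
        show "norm (complementary P j x) \<le> norm (complementary P j) * N m x"
          by (rule order_trans[OF norm_blinfun mult_left_mono[OF norm_N norm_ge_zero]])
        show "0 \<le> e j * k n"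
          using e1[of j] k[of n] by simp
      qed
      also have "\<dots> = b j * (k n * N m x)"
        by (simp add: b_def)
      finally show "k j * N n z \<le> b j * (k n * N m x)" .
    qed
    also have "\<dots> = (\<Sum>j=n..m. b j) * (k n * N m x)"
      by (simp add: sum_distrib_right)
    also have "\<dots> \<le> d m * (k n * N m x)"
    proof (rule mult_right_mono)
      have "(\<Sum>j=n..m. b j) \<le> (\<Sum>j\<le>m. b j)"
        by (rule sum_mono2) (use b0 in auto)
      also have "\<dots> \<le> (\<Sum>j\<le>m. H * h j / h' j + b j)"
        by (rule sum_mono) (use c0 in simp)
      finally show "(\<Sum>j=n..m. b j) \<le> d m" by (simp add: d_def)
      show "0 \<le> k n * N m x"
        using k[of n] N0[of m x] by simp
    qed
    finally show ?thesis by (simp add: mult.assoc)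
  qed
  ultimately show ?thesis by blast
qed

end
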